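(* Let $q\in\mathbb{N}$, let $\mathbb{X}=[0,1]$ (so $d=1$), let $\mathbb{Y}\subset\mathbb{R}^q$ be compact, and let $\mathbb{Z}=\mathbb{X}\times\mathbb{Y}$. Let $f\in\mathcal{F}$ be a conditional probability density function that is continuous on $\mathbb{Z}$, and let $\psi:\mathbb{R}^q\to[0,\infty)$ be a continuous probability density function on $\mathbb{R}^q$. Then there exists a sequence $\{m_K^\psi\}_{K\in\mathbb{N}}\subset\mathcal{M}_S^\psi$ of soft-max gated mixture of experts models such that $\lim_{K\to\infty}m_K^\psi=f$ almost uniformly on $\mathbb{Z}$; that is, for every $\delta>0$ there exists a measurable set $\mathbb{E}_\delta\subset\mathbb{Z}$ with $\lambda(\mathbb{E}_\delta)<\delta$ such that $\{m_K^\psi\}_{K\in\mathbb{N}}$ converges to $f$ uniformly on $\mathbb{Z}\setminus\mathbb{E}_\delta$.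
   Context: $\lambda$ denotes Lebesgue measure (on the space of the relevant dimension), and $[K]=\{1,\dots,K\}$. The class of conditional PDFs is $$\mathcal{F}=\left\{f:\mathbb{Z}\to[0,\infty)\ \Big|\ \int_{\mathbb{Y}}f(\boldsymbol{y}|x)\,\mathrm{d}\lambda(\boldsymbol{y})=1\ \text{for all }x\in\mathbb{X}\right\},$$ where $f(\boldsymbol{y}|x)$ denotes the value of $f$ at $(x,\boldsymbol{y})\in\mathbb{Z}$. $\mathcal{L}_\infty$ is the class of essentially bounded functions. A PDF $\psi$ on $\mathbb{R}^q$ is a function $\psi:\mathbb{R}^q\to[0,\infty)$ with $\int_{\mathbb{R}^q}\psi\,\mathrm{d}\lambda=1$. The location-scale class generated by $\psi$ is the class $\mathcal{E}_\psi$ of functions $g_\psi(\cdot;\boldsymbol{\mu},\sigma):\mathbb{Y}\to[0,\infty)$, $g_\psi(\boldsymbol{y};\boldsymbol{\mu},\sigma)=\sigma^{-q}\psi\left((\boldsymbol{y}-\boldsymbol{\mu})/\sigma\right)$, with $\boldsymbol{\mu}\in\mathbb{R}^q$, $\sigma\in(0,\infty)$. The soft-max gating class $\mathcal{G}_S^K$ (for $d=1$) is the set of all vectors $\mathbf{Gate}=(\mathrm{Gate}_k)_{k\in[K]}$ of functions on $\mathbb{X}$ of the form $$\mathrm{Gate}_k(x)=\frac{\exp(a_k+b_kx)}{\sum_{l=1}^K\exp(a_l+b_lx)},\qquad k\in[K],$$ with $a_1,\dots,a_K,b_1,\dots,b_K\in\mathbb{R}$. The class $\mathcal{M}_S^\psi$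 of soft-max gated mixture of experts models is the set of all functions $m:\mathbb{Z}\to[0,\infty)$ of the form $$m(\boldsymbol{y}|x)=\sum_{k=1}^K\mathrm{Gate}_k(x)\,g_\psi(\boldsymbol{y};\boldsymbol{\mu}_k,\sigma_k),$$ with $K\in\mathbb{N}$, $\mathbf{Gate}\in\mathcal{G}_S^K$, $\boldsymbol{\mu}_k\in\mathbb{Y}$, $\sigma_k\in(0,\infty)$, and $g_\psi(\cdot;\boldsymbol{\mu}_k,\sigma_k)\in\mathcal{E}_\psi\cap\mathcal{L}_\infty$ for $k\in[K]$. *)

theory Defs
  imports "HOL-Analysis.Analysis"
begin

text \<open>
  Functions with domain \<open>X\<close>, \<open>Y\<close> or \<open>X \<times> Y\<close> are represented by total functions of which only
  the values on that domain are constrained; the function classes below are closed under changing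
  values off the domain. The conditional value \<open>f(y|x)\<close> is written \<open>f (x, y)\<close>.
\<close>

definition cond_pdfs :: "real set \<Rightarrow> (real ^ 'q) set \<Rightarrow> (real \<times> (real ^ 'q) \<Rightarrow> real) set" where
  "cond_pdfs X Y =
    {f. f \<in> X \<times> Y \<rightarrow> {0..} \<and>
        (\<forall>x\<in>X. has_bochner_integral (lebesgue_on Y) (\<lambda>y. f (x, y)) 1)}"

definition is_pdf :: "(real ^ 'q \<Rightarrow> real) \<Rightarrow> bool" where
  "is_pdf \<psi> \<longleftrightarrow> (\<forall>y. 0 \<le> \<psi> y) \<and> has_bochner_integral lebesgue \<psi> 1"

definition ess_bounded :: "'a measure \<Rightarrow> ('a \<Rightarrow> real) set" where
  "ess_bounded M = {g \<in> borel_measurable M. \<exists>C. AE y in M. \<bar>g y\<bar> \<le> C}"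

definition loc_scale :: "(real ^ 'q \<Rightarrow> real) \<Rightarrow> real ^ 'q \<Rightarrow> real \<Rightarrow> real ^ 'q \<Rightarrow> real" where
  "loc_scale \<psi> \<mu> \<sigma> y = \<psi> ((y - \<mu>) /\<^sub>R \<sigma>) / \<sigma> ^ CARD('q)"

definition loc_scale_class ::
    "(real ^ 'q \<Rightarrow> real) \<Rightarrow> (real ^ 'q) set \<Rightarrow> (real ^ 'q \<Rightarrow> real) set" where
  "loc_scale_class \<psi> Y = {g. \<exists>\<mu> \<sigma>. 0 < \<sigma> \<and> (\<forall>y\<in>Y. g y = loc_scale \<psi> \<mu> \<sigma> y)}"

definition softmax_gates :: "nat \<Rightarrow> real set \<Rightarrow> (nat \<Rightarrow> real \<Rightarrow> real) set" where
  "softmax_gates K X =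
    {Gate. \<exists>a b :: nat \<Rightarrow> real. \<forall>k\<in>{1..K}. \<forall>x\<in>X.
       Gate k x = exp (a k + b k * x) / (\<Sum>l=1..K. exp (a l + b l * x))}"

definition softmax_moe ::
    "(real ^ 'q \<Rightarrow> real) \<Rightarrow> real set \<Rightarrow> (real ^ 'q) set \<Rightarrow> (real \<times> (real ^ 'q) \<Rightarrow> real) set" where
  "softmax_moe \<psi> X Y =
    {m. m \<in> X \<times> Y \<rightarrow> {0..} \<and>
        (\<exists>K Gate \<mu> \<sigma>. 1 \<le> K \<and> Gate \<in> softmax_gates K X \<and>
          (\<forall>k\<in>{1..K}. \<mu> k \<in> Y \<and> 0 < \<sigma> k \<and>
             loc_scale \<psi> (\<mu> k) (\<sigma> k) \<in> loc_scale_class \<psi> Y \<inter> ess_bounded (lebesgue_on Y)) \<and>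
          (\<forall>x\<in>X. \<forall>y\<in>Y. m (x, y) = (\<Sum>k=1..K. Gate k x * loc_scale \<psi> (\<mu> k) (\<sigma> k) y)))}"

text \<open>
  Almost uniform convergence on \<open>Z\<close> with respect to Lebesgue measure. The exceptional set is
  bounded in \<open>emeasure\<close>, since \<open>measure\<close> assigns 0 to sets of infinite measure.
\<close>

definition almost_uniform_limit ::
    "'a::euclidean_space set \<Rightarrow> (nat \<Rightarrow> 'a \<Rightarrow> real) \<Rightarrow> ('a \<Rightarrow> real) \<Rightarrow> bool" where
  "almost_uniform_limit Z m f \<longleftrightarrow>
    (\<forall>\<delta>>0. \<exists>E. E \<in> sets lebesgue \<and> E \<subseteq> Z \<and> emeasure lebesgue E < ennreal \<delta> \<and>
       uniform_limit (Z - E) m f sequentially)"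

end

theory Submission
  imports Defs
begin

text \<open>
  For a small bandwidth \<open>\<sigma>\<close> the convolution of \<open>f(\<cdot>|x)\<close>, extended by zero off \<open>Y\<close>, with the
  rescaled \<open>\<psi>\<close> is close to \<open>f(y|x)\<close>, uniformly in \<open>x\<close>, unless a non-negligible part of the mass of
  the kernel centred at \<open>y\<close> leaks out of \<open>Y\<close>. By Tonelli and Markov the set of such \<open>y\<close> is small,
  because the measure of \<open>Y - (Y + h)\<close> tends to zero with \<open>h\<close>. For fixed \<open>x\<close> the convolution
  is an average of kernels centred in \<open>Y\<close> with respect to the probability density \<open>f(\<cdot>|x)\<close>, hence uniformly
  close to a finite mixture with weights summing to one. Finally, the gates proportional to
  \<open>exp (- t (x - i/n)\<^sup>2)\<close> are of soft-max form, since the factor \<open>exp (- t x\<^sup>2)\<close> cancels, and for large \<open>t\<close> they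
  concentrate on the grid points near \<open>x\<close>; they glue the finite mixtures found at the grid
  points, whose weights are absorbed into the intercepts as logarithms.
\<close>

section \<open>Mass pushed out of a compact set by small translations\<close>

text \<open>Outer regularity gives an open \<open>U\<close> around \<open>Y\<close> with
  \<open>U - Y\<close> small, and compactness puts a whole \<eta>-neighbourhood of \<open>Y\<close>
  inside \<open>U\<close>. A point of \<open>Y\<close> that leaves \<open>Y\<close> under a shift
  shorter than \<eta> lands in \<open>U - Y\<close>, and Lebesgue measure is translation
  invariant.\<close>

lemma compact_translation_small:
  fixes Y :: "'a::euclidean_space set"
  assumes "compact Y" "0 < e"
  obtains \<eta> where "0 < \<eta>" "\<And>h. norm h < \<eta> \<Longrightarrow> emeasure lborel {y \<in> Y. y - h \<notin> Y} \<le> ennreal e"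
proof -
  have Ym: "Y \<in> lmeasurable" using assms lmeasurable_compact by auto
  obtain U where U: "open U" "Y \<subseteq> U" "(U - Y) \<in> lmeasurable" "emeasure lebesgue (U - Y) < ennreal e"
    using sets_lebesgue_outer_open[of Y e] Ym assms by (auto simp: fmeasurableD)
  obtain \<eta> where \<eta>: "0 < \<eta>" "(\<Union>x\<in>Y. ball x \<eta>) \<subseteq> U"
    using compact_subset_open_imp_ball_epsilon_subset[OF assms(1) U(1,2)] by auto
  have Yb: "Y \<in> sets borel" using assms(1) by (rule borel_compact)
  note [measurable] = Yb borel_open[OF U(1)]
  have UYb: "U - Y \<in> sets borel" by measurable
  show thesis
  proof (rule that[OF \<eta>(1)])
    fix h :: 'a assume h: "norm h < \<eta>"
    have sub: "{y \<in> Y. y - h \<notin> Y} \<subseteq> {y. - h + y \<in> U - Y}"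
    proof clarsimp
      fix y assume "y \<in> Y" "y - h \<notin> Y"
      moreover have "y - h \<in> ball y \<eta>" using h by (simp add: dist_norm)
      ultimately show "y - h \<in> U" using \<eta>(2) by blast
    qed
    have "emeasure lborel {y \<in> Y. y - h \<notin> Y} \<le> emeasure lborel {y. - h + y \<in> U - Y}"
      by (intro emeasure_mono sub) measurable
    also have "{y. - h + y \<in> U - Y} = (+) (- h) -` (U - Y) \<inter> space lborel" by auto
    also have "emeasure lborel \<dots> = emeasure (distr lborel borel ((+) (- h))) (U - Y)"
      using UYb by (subst emeasure_distr) auto
    also have "\<dots> = emeasure lborel (U - Y)" by (simp add: lborel_distr_plus)
    also have "\<dots> < ennreal e" using U(4) UYb by simp
    finally show "emeasure lborel {y \<in> Y. y - h \<notin> Y} \<le> ennreal e" by simp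
  qed
qed

lemma finite_measure_norm_tail:
  fixes N :: "'a::real_normed_vector measure"
  assumes "finite_measure N" "sets N = sets borel" "0 < e"
  obtains R where "0 < R" "measure N {z. R \<le> norm z} \<le> e"
proof -
  interpret finite_measure N by fact
  let ?A = "\<lambda>n::nat. {z::'a. real n \<le> norm z}"
  have "(\<lambda>n. measure N (?A n)) \<longlonglongrightarrow> measure N (\<Inter>n. ?A n)"
  proof (rule finite_Lim_measure_decseq)
    show "range ?A \<subseteq> sets N" unfolding assms(2) by auto
    show "decseq ?A" by (auto simp: decseq_def)
  qed
  moreover have "(\<Inter>n. ?A n) = {}"
    using reals_Archimedean2 not_le by blast
  ultimately have "(\<lambda>n. measure N (?A n)) \<longlonglongrightarrow> 0" by simp
  then have "\<forall>\<^sub>F n in sequentially. measure N (?A n) < e \<and> 0 < n"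
    using order_tendstoD(2) assms(3) eventually_gt_at_top eventually_conj by blast
  then obtain n where "measure N (?A n) < e" "0 < n"
    by (auto dest: eventually_happens)
  then show thesis by (intro that[of "real n"]) auto
qed

text \<open>Integrating the leaking mass over \<open>y \<in> Y\<close> and swapping the integrals
  gives the \<open>N\<close>-average over \<open>z\<close> of the measure of the points that the
  shift by \<open>\<sigma> *\<^sub>R z\<close> moves out of \<open>Y\<close>. This is small for
  \<open>norm z < R\<close> by translation and at most the measure of \<open>Y\<close> on the tail.
  Markov's inequality then yields \<open>E\<close>.\<close>

lemma mollifier_leak_small:
  fixes N :: "'a::euclidean_space measure"
  assumes N: "finite_measure N" "sets N = sets borel" and Y: "compact Y" and e: "0 < e"
  obtains s where "0 < s"
    "\<And>\<sigma>. 0 < \<sigma> \<Longrightarrow> \<sigma> < s \<Longrightarrow> \<exists>E\<in>sets borel. E \<subseteq> Y \<and> emeasure lborel E \<le> ennreal e \<and>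
        (\<forall>y\<in>Y - E. measure N {z. y - \<sigma> *\<^sub>R z \<notin> Y} \<le> e)"
proof -
  interpret finite_measure N by fact
  have spN[simp]: "space N = UNIV" using N(2) sets_eq_imp_space_eq by fastforce
  have Yb[measurable]: "Y \<in> sets borel" using Y by (rule borel_compact)
  have Yfin: "emeasure lborel Y < \<infinity>" using Y emeasure_compact_finite by blast
  define L where "L = measure lborel Y + measure N UNIV + 1"
  have L: "L > 0" by (simp add: L_def add_nonneg_pos)
  \<comment> \<open>The leak will integrate to at most \<open>c * L\<close>, hence to at most
    \<open>e * e\<close>, and Markov's inequality at level \<open>e\<close> leaves measure at most
    \<open>e\<close>. The summand 1 in \<open>L\<close> makes the divisor positive.\<close>
  define c where "c = e * e / (2 * L)"
  have c: "c > 0" using L e by (simp add: c_def)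
  obtain R where R: "0 < R" "measure N {z. R \<le> norm z} \<le> c"
    using finite_measure_norm_tail[OF N c] .
  obtain \<eta> where \<eta>: "0 < \<eta>" "\<And>h. norm h < \<eta> \<Longrightarrow> emeasure lborel {y \<in> Y. y - h \<notin> Y} \<le> ennreal c"
    using compact_translation_small[OF Y c] by metis
  show thesis
  proof (rule that)
    \<comment> \<open>Below this threshold the shift \<open>\<sigma> *\<^sub>R z\<close> is shorter
      than \<eta> whenever \<open>norm z < R\<close>.\<close>
    show "0 < \<eta> / R" using R \<eta> by simp
    fix \<sigma> :: real assume \<sigma>: "0 < \<sigma>" "\<sigma> < \<eta> / R"
    have [measurable_cong]: "sets N = sets borel" by fact
    define Q where "Q y = emeasure N {z. y - \<sigma> *\<^sub>R z \<notin> Y}" for y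
    have Qm: "{z. y - \<sigma> *\<^sub>R z \<notin> Y} \<in> sets N" for y
      unfolding N(2) by measurable
    have Qeq: "Q y = (\<integral>\<^sup>+z. indicator (- Y) (y - \<sigma> *\<^sub>R z) \<partial>N)" for y
    proof -
      have "(\<lambda>z. indicator (- Y) (y - \<sigma> *\<^sub>R z) :: ennreal) = indicator {z. y - \<sigma> *\<^sub>R z \<notin> Y}"
        by (auto simp: indicator_def fun_eq_iff)
      then show ?thesis unfolding Q_def using nn_integral_indicator[OF Qm] by simp
    qed
    interpret pair_sigma_finite N lborel by unfold_locales
    have meas: "(\<lambda>(z, y). indicator (- Y) (y - \<sigma> *\<^sub>R z) * indicator Y y :: ennreal) \<in> borel_measurable (N \<Otimes>\<^sub>M lborel)"
      by measurable
    have [measurable]: "Q \<in> borel_measurable borel"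
      unfolding Qeq by measurable
    have "(\<integral>\<^sup>+y. Q y * indicator Y y \<partial>lborel) =
        (\<integral>\<^sup>+y. (\<integral>\<^sup>+z. indicator (- Y) (y - \<sigma> *\<^sub>R z) * indicator Y y \<partial>N) \<partial>lborel)"
      unfolding Qeq by (intro nn_integral_cong nn_integral_multc[symmetric]) measurable
    also have "\<dots> = (\<integral>\<^sup>+z. (\<integral>\<^sup>+y. indicator (- Y) (y - \<sigma> *\<^sub>R z) * indicator Y y \<partial>lborel) \<partial>N)"
      using Fubini'[OF meas] by simp
    also have "\<dots> = (\<integral>\<^sup>+z. emeasure lborel {y \<in> Y. y - \<sigma> *\<^sub>R z \<notin> Y} \<partial>N)"
    proof (rule nn_integral_cong)
      fix z
      have "(\<lambda>y. indicator (- Y) (y - \<sigma> *\<^sub>R z) * indicator Y y :: ennreal)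
          = indicator {y \<in> Y. y - \<sigma> *\<^sub>R z \<notin> Y}"
        by (auto simp: indicator_def fun_eq_iff)
      then show "(\<integral>\<^sup>+y. indicator (- Y) (y - \<sigma> *\<^sub>R z) * indicator Y y \<partial>lborel)
          = emeasure lborel {y \<in> Y. y - \<sigma> *\<^sub>R z \<notin> Y}"
        by simp
    qed
    also have "\<dots> \<le> (\<integral>\<^sup>+z. ennreal c + emeasure lborel Y * indicator {z. R \<le> norm z} z \<partial>N)"
    proof (rule nn_integral_mono)
      fix z
      show "emeasure lborel {y \<in> Y. y - \<sigma> *\<^sub>R z \<notin> Y} \<le> ennreal c + emeasure lborel Y * indicator {z. R \<le> norm z} z"
      proof (cases "R \<le> norm z")
        case True
        have "emeasure lborel {y \<in> Y. y - \<sigma> *\<^sub>R z \<notin> Y} \<le> emeasure lborel Y"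
          by (intro emeasure_mono) auto
        then show ?thesis using True by (simp add: add_increasing)
      next
        case False
        then have "\<sigma> * norm z < \<eta> / R * R" using \<sigma> R by (intro mult_strict_mono') auto
        then have "norm (\<sigma> *\<^sub>R z) < \<eta>" using \<sigma> R by simp
        from \<eta>(2)[OF this] show ?thesis using False by simp
      qed
    qed
    also have "\<dots> = ennreal c * emeasure N UNIV + emeasure lborel Y * emeasure N {z. R \<le> norm z}"
      by (subst nn_integral_add) (auto simp: nn_integral_cmult_indicator)
    also have "\<dots> = ennreal (c * measure N UNIV + measure lborel Y * measure N {z. R \<le> norm z})"
      using Yfin c by (simp add: emeasure_eq_measure emeasure_eq_ennreal_measure ennreal_mult ennreal_plus)
    also have "\<dots> \<le> ennreal (c * (2 * L))"
    proof (rule ennreal_leI)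
      have "measure lborel Y * measure N {z. R \<le> norm z} \<le> measure lborel Y * c"
        using R(2) by (intro mult_left_mono) auto
      moreover have "c * measure N UNIV + measure lborel Y * c \<le> c * L"
        using c by (simp add: L_def algebra_simps)
      moreover have "c * L \<le> c * (2 * L)" using c L by simp
      ultimately show "c * measure N UNIV + measure lborel Y * measure N {z. R \<le> norm z} \<le> c * (2 * L)" by linarith
    qed
    also have "c * (2 * L) = e * e" using L by (simp add: c_def)
    finally have bound: "(\<integral>\<^sup>+y. Q y * indicator Y y \<partial>lborel) \<le> ennreal (e * e)" .
    define E where "E = {y \<in> Y. ennreal e < Q y}"
    have Eb: "E \<in> sets borel" unfolding E_def by measurable
    \<comment> \<open>Markov's inequality: on \<open>E\<close> the constant \<open>e\<close> is
      dominated by \<open>Q\<close>.\<close>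
    have "ennreal e * emeasure lborel E = (\<integral>\<^sup>+y. ennreal e * indicator E y \<partial>lborel)"
      using Eb by (simp add: nn_integral_cmult_indicator)
    also have "\<dots> \<le> (\<integral>\<^sup>+y. Q y * indicator Y y \<partial>lborel)"
      by (intro nn_integral_mono) (auto simp: E_def indicator_def)
    also note bound
    finally have EE: "ennreal e * emeasure lborel E \<le> ennreal e * ennreal e" using e by (simp add: ennreal_mult)
    then have "emeasure lborel E \<le> ennreal e"
      using e by (simp add: ennreal_mult_le_mult_iff)
    moreover have "measure N {z. y - \<sigma> *\<^sub>R z \<notin> Y} \<le> e" if "y \<in> Y - E" for y
    proof -
      have "Q y \<le> ennreal e" using that by (auto simp: E_def not_less)
      then show ?thesis using e by (simp add: Q_def emeasure_eq_measure)
    qed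
    ultimately show "\<exists>E\<in>sets borel. E \<subseteq> Y \<and> emeasure lborel E \<le> ennreal e \<and>
        (\<forall>y\<in>Y - E. measure N {z. y - \<sigma> *\<^sub>R z \<notin> Y} \<le> e)"
      using Eb by (intro bexI[of _ E]) (auto simp: E_def)
  qed
qed

section \<open>Uniform approximation by convolution with a rescaled kernel\<close>

text \<open>The error at \<open>y\<close> is an average of differences of values of
  \<open>f\<close>, taken as zero off \<open>Y\<close>. Uniform continuity controls the bounded
  \<open>z\<close> that stay in \<open>Y\<close>; the tail has small mass, and so has the leak when
  \<open>y\<close> is off \<open>E\<close>. Since \<open>E\<close> is obtained before
  \<open>x\<close> is fixed, one set serves every \<open>x \<in> S\<close>.\<close>

lemma mollifier_approx:
  fixes N :: "'a::euclidean_space measure" and f :: "'b::metric_space \<times> 'a \<Rightarrow> real"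
  assumes N: "finite_measure N" "sets N = sets borel" "measure N UNIV = 1"
    and S: "compact S" and Y: "compact Y" and f: "continuous_on (S \<times> Y) f" and e: "0 < e"
  obtains \<sigma> E where "0 < \<sigma>" "E \<in> sets borel" "E \<subseteq> Y" "emeasure lborel E \<le> ennreal e"
    "\<And>x y. x \<in> S \<Longrightarrow> y \<in> Y - E \<Longrightarrow>
      \<bar>f (x, y) - (\<integral>z. indicator Y (y - \<sigma> *\<^sub>R z) * f (x, y - \<sigma> *\<^sub>R z) \<partial>N)\<bar> \<le> e"
proof -
  interpret finite_measure N by fact
  have spN[simp]: "space N = UNIV" using N(2) sets_eq_imp_space_eq by fastforce
  have [measurable_cong]: "sets N = sets borel" by fact
  have Yb[measurable]: "Y \<in> sets borel" using Y by (rule borel_compact)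
  have SY: "compact (S \<times> Y)" using S Y by (rule compact_Times)
  obtain M where M: "0 < M" "\<And>p. p \<in> S \<times> Y \<Longrightarrow> \<bar>f p\<bar> \<le> M"
    using compact_imp_bounded[OF compact_continuous_image[OF f SY]] unfolding bounded_pos by auto
  obtain d where d: "0 < d" "\<And>p p'. p \<in> S \<times> Y \<Longrightarrow> p' \<in> S \<times> Y \<Longrightarrow> dist p' p < d \<Longrightarrow> dist (f p') (f p) < e/2"
    using uniformly_continuous_onE[OF compact_uniformly_continuous[OF f SY], of "e/2"] e by auto
  \<comment> \<open>The tail costs up to \<open>2 * M\<close> per unit of mass and the leak up to
    \<open>M\<close>, so mass \<open>c\<close> for each costs at most \<open>e / 2\<close>; the
    other half is left for uniform continuity.\<close>
  define c where "c = e / (6 * (M + 1))"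
  have c: "0 < c" "c \<le> e" "3 * M * c \<le> e / 2" using e M by (auto simp: c_def field_simps)
  obtain R where R: "0 < R" "measure N {z. R \<le> norm z} \<le> c"
    using finite_measure_norm_tail[OF N(1,2) c(1)] .
  obtain s where s: "0 < s"
    "\<And>\<sigma>. 0 < \<sigma> \<Longrightarrow> \<sigma> < s \<Longrightarrow> \<exists>E\<in>sets borel. E \<subseteq> Y \<and> emeasure lborel E \<le> ennreal c \<and>
        (\<forall>y\<in>Y - E. measure N {z. y - \<sigma> *\<^sub>R z \<notin> Y} \<le> c)"
    using mollifier_leak_small[OF N(1,2) Y c(1)] by blast
  \<comment> \<open>\<open>s/2\<close> ensures the strict bound \<open>\<sigma> < s\<close>;
    \<open>d / R\<close> keeps the displacement below \<open>d\<close> for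
    \<open>norm z < R\<close>.\<close>
  define \<sigma> where "\<sigma> = min (s/2) (d / R)"
  have \<sigma>: "0 < \<sigma>" "\<sigma> < s" "\<sigma> \<le> d / R" using s(1) d(1) R(1) by (auto simp: \<sigma>_def)
  obtain E where E: "E \<in> sets borel" "E \<subseteq> Y" "emeasure lborel E \<le> ennreal c"
     "\<And>y. y \<in> Y - E \<Longrightarrow> measure N {z. y - \<sigma> *\<^sub>R z \<notin> Y} \<le> c"
    using s(2)[OF \<sigma>(1,2)] by blast
  show thesis
  proof (rule that[OF \<sigma>(1) E(1,2)])
    show "emeasure lborel E \<le> ennreal e" using E(3) c(2) by (meson ennreal_leI order_trans)
    fix x y assume x: "x \<in> S" and y: "y \<in> Y - E"
    define g where "g z = indicator Y (y - \<sigma> *\<^sub>R z) * f (x, y - \<sigma> *\<^sub>R z)" for z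
    have "continuous_on Y (\<lambda>\<mu>. f (x, \<mu>))"
      using x by (intro continuous_on_compose2[OF f]) (auto intro!: continuous_intros)
    then have [measurable]: "(\<lambda>\<mu>. indicator Y \<mu> *\<^sub>R f (x, \<mu>)) \<in> borel_measurable borel"
      by (intro borel_measurable_continuous_on_indicator Yb)
    have "(\<lambda>z. indicator Y (y - \<sigma> *\<^sub>R z) *\<^sub>R f (x, y - \<sigma> *\<^sub>R z)) \<in> borel_measurable N"
      by (rule measurable_compose[of "\<lambda>z. y - \<sigma> *\<^sub>R z" N borel]) measurable
    then have gm[measurable]: "g \<in> borel_measurable N" by (simp add: g_def[abs_def])
    have gb: "\<bar>g z\<bar> \<le> M" for z
      using M x by (auto simp: g_def indicator_def)
    have gi: "integrable N g" by (rule integrable_const_bound[of _ M]) (auto simp: gb)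
    have A[measurable]: "{z. R \<le> norm z} \<in> sets N" unfolding N(2) by measurable
    have B[measurable]: "{z. y - \<sigma> *\<^sub>R z \<notin> Y} \<in> sets N" unfolding N(2) by measurable
    \<comment> \<open>\<open>N\<close> has total mass 1, so the constant \<open>f (x, y)\<close> is
      its own average.\<close>
    have "f (x, y) - (\<integral>z. g z \<partial>N) = (\<integral>z. f (x, y) - g z \<partial>N)"
      using gi N(3) by simp
    also have "\<bar>\<dots>\<bar> \<le> (\<integral>z. e / 2 + 2 * M * indicator {z. R \<le> norm z} z
        + M * indicator {z. y - \<sigma> *\<^sub>R z \<notin> Y} z \<partial>N)"
    proof (rule integral_abs_bound_integral)
      fix z
      have fy: "\<bar>f (x, y)\<bar> \<le> M" using x y M(2) by auto
      show "\<bar>f (x, y) - g z\<bar> \<le> e / 2 + 2 * M * indicator {z. R \<le> norm z} z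
        + M * indicator {z. y - \<sigma> *\<^sub>R z \<notin> Y} z"
      proof (cases "y - \<sigma> *\<^sub>R z \<in> Y")
        case False then show ?thesis using fy M e by (simp add: g_def indicator_def)
      next
        case True
        show ?thesis
        proof (cases "R \<le> norm z")
          case True
          have "\<bar>f (x, y) - g z\<bar> \<le> 2 * M" using fy gb[of z] by linarith
          then show ?thesis using True \<open>y - \<sigma> *\<^sub>R z \<in> Y\<close> e by simp
        next
          case False
          have "\<sigma> * norm z < d"
            using False \<sigma>(1,3) R by (smt (verit, best) mult_less_cancel_left_pos pos_le_divide_eq)
          then have "dist (x, y - \<sigma> *\<^sub>R z) (x, y) < d"
            using \<sigma> by (simp add: dist_Pair_Pair dist_norm)
          from d(2)[OF _ _ this] x y True have "dist (f (x, y - \<sigma> *\<^sub>R z)) (f (x, y)) < e / 2" by auto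
          then show ?thesis using True False by (simp add: g_def dist_real_def abs_minus_commute)
        qed
      qed
    qed (use gi A B in \<open>auto intro!: integrable_real_indicator simp: emeasure_eq_measure\<close>)
    also have "\<dots> = e / 2 + 2 * M * measure N {z. R \<le> norm z} + M * measure N {z. y - \<sigma> *\<^sub>R z \<notin> Y}"
      using A B N(3) by (simp add: emeasure_eq_measure)
    also have "\<dots> \<le> e / 2 + 2 * M * c + M * c"
      using R(2) E(4)[OF y] M(1) by (intro add_mono mult_left_mono) auto
    also have "\<dots> \<le> e" using c(3) by simp
    finally show "\<bar>f (x, y) - (\<integral>z. indicator Y (y - \<sigma> *\<^sub>R z) * f (x, y - \<sigma> *\<^sub>R z) \<partial>N)\<bar> \<le> e"
      by (simp add: g_def)
  qed
qed

section \<open>Convolutions as finite mixtures of kernels\<close>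

text \<open>The substitution \<open>\<mu> = y - \<sigma> *\<^sub>R z\<close> turns an average over
  displacements into a mixture over kernel centres; the Jacobian \<open>\<sigma> ^ CARD('q)\<close>
  cancels the normalisation in \<open>loc_scale\<close>.\<close>

lemma integral_mollifier_eq_loc_scale:
  fixes \<psi> :: "real ^ 'q \<Rightarrow> real" and g :: "real ^ 'q \<Rightarrow> real"
  assumes [measurable]: "g \<in> borel_measurable borel" "\<psi> \<in> borel_measurable borel"
    and nn: "\<And>z. 0 \<le> \<psi> z" and \<sigma>: "0 < \<sigma>"
  shows "(\<integral>z. g (y - \<sigma> *\<^sub>R z) \<partial>density lborel \<psi>) = (\<integral>\<mu>. g \<mu> * loc_scale \<psi> \<mu> \<sigma> y \<partial>lborel)"
proof -
  have [measurable]: "(\<lambda>\<mu>. g \<mu> * loc_scale \<psi> \<mu> \<sigma> y) \<in> borel_measurable borel"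
    unfolding loc_scale_def by measurable
  have aff: "lborel = density (distr lborel borel (\<lambda>z. y + (- \<sigma>) *\<^sub>R z)) (\<lambda>_. ennreal (\<sigma> ^ CARD('q)))"
    using lborel_affine[of "- \<sigma>" y] \<sigma> by simp
  have "(\<integral>\<mu>. g \<mu> * loc_scale \<psi> \<mu> \<sigma> y \<partial>lborel)
      = (\<integral>z. \<sigma> ^ CARD('q) *\<^sub>R (g (y + (- \<sigma>) *\<^sub>R z) * loc_scale \<psi> (y + (- \<sigma>) *\<^sub>R z) \<sigma> y) \<partial>lborel)"
    using \<sigma> by (subst aff, subst integral_density) (auto simp: integral_distr)
  also have "\<dots> = (\<integral>z. \<psi> z *\<^sub>R g (y - \<sigma> *\<^sub>R z) \<partial>lborel)"
    using \<sigma> by (intro Bochner_Integration.integral_cong) (auto simp: loc_scale_def)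
  also have "\<dots> = (\<integral>z. g (y - \<sigma> *\<^sub>R z) \<partial>density lborel \<psi>)"
    using nn by (subst integral_density) auto
  finally show ?thesis ..
qed

text \<open>The density \<open>p\<close> is split by a partition of unity over a finite cover of
  \<open>Y\<close> by balls of radius \<open>d\<close>. In each piece \<mu> is replaced by the
  centre \<open>t\<close>, whose weight is the mass of the piece. Uniform continuity of
  \<open>g\<close> on \<open>Z \<times> Y\<close> makes one choice of centres and weights good for
  all \<open>y \<in> Z\<close>.\<close>

lemma integral_kernel_discretise:
  fixes p :: "'a::euclidean_space \<Rightarrow> real" and g :: "'b::metric_space \<times> 'a \<Rightarrow> real"
  assumes Y: "compact Y" and Z: "compact Z" and g: "continuous_on (Z \<times> Y) g"
    and p: "has_bochner_integral lborel p 1" "\<And>\<mu>. 0 \<le> p \<mu>" "\<And>\<mu>. \<mu> \<notin> Y \<Longrightarrow> p \<mu> = 0" and e: "0 < e"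
  obtains T w where "finite T" "T \<subseteq> Y" "\<And>t. t \<in> T \<Longrightarrow> 0 < w t" "(\<Sum>t\<in>T. w t) = 1"
    "\<And>y. y \<in> Z \<Longrightarrow> \<bar>(\<integral>\<mu>. p \<mu> * g (y, \<mu>) \<partial>lborel) - (\<Sum>t\<in>T. w t * g (y, t))\<bar> \<le> e"
proof -
  have Yb[measurable]: "Y \<in> sets borel" using Y by (rule borel_compact)
  have ZY: "compact (Z \<times> Y)" using Z Y by (rule compact_Times)
  obtain M where M: "0 < M" "\<And>p. p \<in> Z \<times> Y \<Longrightarrow> \<bar>g p\<bar> \<le> M"
    using compact_imp_bounded[OF compact_continuous_image[OF g ZY]] unfolding bounded_pos by auto
  obtain d where d: "0 < d" "\<And>p p'. p \<in> Z \<times> Y \<Longrightarrow> p' \<in> Z \<times> Y \<Longrightarrow> dist p' p < d \<Longrightarrow> dist (g p') (g p) < e"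
    using uniformly_continuous_onE[OF compact_uniformly_continuous[OF g ZY] e] by metis
  obtain T where T: "finite T" "T \<subseteq> Y" "Y \<subseteq> (\<Union>t\<in>T. ball t d)"
    using compactE_image[OF Y, of Y "\<lambda>t. ball t d"] d(1) by (metis UN_I centre_in_ball open_ball subsetI)
  have pI: "integrable lborel p" "integral\<^sup>L lborel p = 1" using p(1) by (auto simp: has_bochner_integral_iff)
  have [measurable]: "p \<in> borel_measurable borel" using borel_measurable_integrable[OF pI(1)] by simp
  \<comment> \<open>The \<open>\<phi> t\<close>, divided by their sum, form a partition of unity on \<open>Y\<close>; off \<open>Y\<close> the sum may vanish, but \<open>p\<close> vanishes too.\<close>
  define \<phi> where "\<phi> t \<mu> = max 0 (d - dist t \<mu>)" for t \<mu> :: 'a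
  define q where "q t \<mu> = p \<mu> * (\<phi> t \<mu> / (\<Sum>u\<in>T. \<phi> u \<mu>))" for t \<mu>
  have \<phi>0: "0 \<le> \<phi> t \<mu>" for t \<mu> by (simp add: \<phi>_def)
  have q0: "0 \<le> q t \<mu>" for t \<mu> unfolding q_def using p(2) \<phi>0 by (simp add: sum_nonneg)
  have qsum: "(\<Sum>t\<in>T. q t \<mu>) = p \<mu>" for \<mu>
  proof (cases "\<mu> \<in> Y")
    case True
    then obtain t where "t \<in> T" "dist t \<mu> < d" using T(3) by auto
    then have "0 < (\<Sum>u\<in>T. \<phi> u \<mu>)" by (intro sum_pos2[OF T(1), of t] \<phi>0) (auto simp: \<phi>_def)
    then show ?thesis by (simp add: q_def flip: sum_distrib_left sum_divide_distrib)
  qed (simp add: q_def p(3))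
  have [measurable]: "\<phi> t \<in> borel_measurable borel" for t
    unfolding \<phi>_def by measurable
  have [measurable]: "q t \<in> borel_measurable borel" for t
    unfolding q_def by measurable
  have qp: "q t \<mu> \<le> p \<mu>" if "t \<in> T" for t \<mu>
    using member_le_sum[OF that, of "\<lambda>t. q t \<mu>"] T(1) q0 qsum by auto
  have qI: "integrable lborel (q t)" if "t \<in> T" for t
    using qp[OF that] q0 by (intro Bochner_Integration.integrable_bound[OF pI(1)]) (auto simp: p(2))
  define w where "w t = (\<integral>\<mu>. q t \<mu> \<partial>lborel)" for t
  have w0: "0 \<le> w t" for t unfolding w_def using q0 by simp
  \<comment> \<open>Centres of weight zero are discarded, because the logarithms of the weights will
    become gate intercepts.\<close>
  define T' where "T' = {t\<in>T. 0 < w t}"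
  have T': "finite T'" "T' \<subseteq> T" using T(1) by (auto simp: T'_def)
  have drop: "(\<Sum>t\<in>T'. w t * h t) = (\<Sum>t\<in>T. w t * h t)" for h :: "'a \<Rightarrow> real"
    using w0 T(1) by (intro sum.mono_neutral_left) (auto simp: T'_def not_less intro: antisym)
  have "(\<Sum>t\<in>T. w t) = (\<integral>\<mu>. (\<Sum>t\<in>T. q t \<mu>) \<partial>lborel)"
    unfolding w_def using qI by (simp add: Bochner_Integration.integral_sum)
  then have w1: "(\<Sum>t\<in>T. w t) = 1" by (simp add: qsum pI)
  show thesis
  proof (rule that[OF T'(1)])
    show "T' \<subseteq> Y" using T T' by auto
    show "0 < w t" if "t \<in> T'" for t using that by (simp add: T'_def)
    show "(\<Sum>t\<in>T'. w t) = 1" using w1 drop[of "\<lambda>_. 1"] by simp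
    fix y assume y: "y \<in> Z"
    have "continuous_on Y (\<lambda>\<mu>. g (y, \<mu>))"
      using y by (intro continuous_on_compose2[OF g]) (auto intro!: continuous_intros)
    then have [measurable]: "(\<lambda>\<mu>. indicator Y \<mu> *\<^sub>R g (y, \<mu>)) \<in> borel_measurable borel"
      by (intro borel_measurable_continuous_on_indicator Yb)
    \<comment> \<open>Continuity of \<open>g\<close> is known over \<open>Y\<close> only. As
      \<open>p\<close> vanishes off \<open>Y\<close>, the indicator can be inserted, which gives
      Borel measurability on the whole space.\<close>
    have pg: "(\<lambda>\<mu>. p \<mu> * g (y, \<mu>)) = (\<lambda>\<mu>. p \<mu> * (indicator Y \<mu> *\<^sub>R g (y, \<mu>)))"
      using p(3) by (auto simp: indicator_def fun_eq_iff)
    have pgI: "integrable lborel (\<lambda>\<mu>. p \<mu> * g (y, \<mu>))"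
    proof (rule Bochner_Integration.integrable_bound)
      show "integrable lborel (\<lambda>\<mu>. M * p \<mu>)" using pI by simp
      show "(\<lambda>\<mu>. p \<mu> * g (y, \<mu>)) \<in> borel_measurable lborel" unfolding pg by measurable
      have "\<bar>p \<mu> * g (y, \<mu>)\<bar> \<le> M * p \<mu>" for \<mu>
        using M(2)[of "(y, \<mu>)"] y p(2)[of \<mu>] p(3)[of \<mu>]
        by (cases "\<mu> \<in> Y") (auto simp: abs_mult mult.commute[of M] intro: mult_left_mono)
      then show "AE \<mu> in lborel. norm (p \<mu> * g (y, \<mu>)) \<le> norm (M * p \<mu>)"
        using M(1) p(2) by (auto simp: abs_mult)
    qed
    have "(\<integral>\<mu>. p \<mu> * g (y, \<mu>) \<partial>lborel) - (\<Sum>t\<in>T'. w t * g (y, t))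
       = (\<integral>\<mu>. p \<mu> * g (y, \<mu>) - (\<Sum>t\<in>T. q t \<mu> * g (y, t)) \<partial>lborel)"
      unfolding drop using pgI qI by (simp add: w_def Bochner_Integration.integral_sum)
    also have "\<bar>\<dots>\<bar> \<le> (\<integral>\<mu>. e * p \<mu> \<partial>lborel)"
    proof (rule integral_abs_bound_integral)
      fix \<mu>
      show "\<bar>p \<mu> * g (y, \<mu>) - (\<Sum>t\<in>T. q t \<mu> * g (y, t))\<bar> \<le> e * p \<mu>"
      proof (cases "\<mu> \<in> Y")
        case False then show ?thesis by (simp add: p(3) q_def)
      next
        case True
        \<comment> \<open>Splitting \<open>p \<mu>\<close> into the \<open>q t \<mu>\<close> brings
          both terms under one sum, in which only the \<open>t\<close> within \<open>d\<close> of
          \<mu> contribute.\<close>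
        have "p \<mu> * g (y, \<mu>) - (\<Sum>t\<in>T. q t \<mu> * g (y, t)) = (\<Sum>t\<in>T. q t \<mu> * (g (y, \<mu>) - g (y, t)))"
          unfolding qsum[symmetric, of \<mu>] by (simp add: sum_distrib_right right_diff_distrib sum_subtractf)
        also have "\<bar>\<dots>\<bar> \<le> (\<Sum>t\<in>T. \<bar>q t \<mu> * (g (y, \<mu>) - g (y, t))\<bar>)" by (rule sum_abs)
        also have "\<dots> \<le> (\<Sum>t\<in>T. q t \<mu> * e)"
        proof (rule sum_mono)
          fix t assume t: "t \<in> T"
          show "\<bar>q t \<mu> * (g (y, \<mu>) - g (y, t))\<bar> \<le> q t \<mu> * e"
          proof (cases "dist t \<mu> < d")
            case False then show ?thesis by (simp add: q_def \<phi>_def)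
          next
            case near: True
            then have "dist (y, \<mu>) (y, t) < d" by (simp add: dist_Pair_Pair dist_commute)
            then have "dist (g (y, \<mu>)) (g (y, t)) < e" using y True t T(2) by (intro d(2)) auto
            then show ?thesis using q0[of t \<mu>] by (auto simp: abs_mult dist_real_def intro!: mult_left_mono)
          qed
        qed
        also have "\<dots> = e * p \<mu>" by (simp add: qsum flip: sum_distrib_right)
        finally show ?thesis .
      qed
    qed (use pgI qI pI in auto)
    also have "\<dots> = e" using pI by simp
    finally show "\<bar>(\<integral>\<mu>. p \<mu> * g (y, \<mu>) \<partial>lborel) - (\<Sum>t\<in>T'. w t * g (y, t))\<bar> \<le> e" .
  qed
qed

section \<open>Soft-max gates concentrating near \<open>x\<close>\<close>

text \<open>With \<open>c = i / n\<close>, the exponent is affine in \<open>x\<close> and equals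
  \<open>t * x\<^sup>2 - t * (x - c)\<^sup>2\<close>, so up to a common factor the terms are
  Gaussian bumps at the grid points. A single grid point within \<open>d / 2\<close> of
  \<open>x\<close> outweighs all those at distance at least \<open>d\<close> together once
  \<open>t\<close> is large.\<close>

lemma softmax_gates_localised:
  fixes d e :: real
  assumes d: "0 < d" and e: "0 < e"
  obtains n :: nat and t :: real where "0 < n"
    "\<And>x. x \<in> {0..1} \<Longrightarrow>
      (\<Sum>i\<in>{i\<in>{..n}. d \<le> \<bar>x - real i / real n\<bar>}. exp (t * (2 * (real i / real n) * x - (real i / real n)\<^sup>2)))
      \<le> e * (\<Sum>i\<le>n. exp (t * (2 * (real i / real n) * x - (real i / real n)\<^sup>2)))"
proof -
  obtain n :: nat where n: "2 / d < real n" using reals_Archimedean2 by blast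
  then have n0: "0 < n" using d by (metis divide_pos_pos less_trans of_nat_0_less_iff zero_less_numeral)
  have nd: "1 / real n \<le> d / 2" using n n0 d by (simp add: field_simps)
  \<comment> \<open>\<open>3 / 4 * d\<^sup>2\<close> is the gap
    \<open>d\<^sup>2 - (d / 2)\<^sup>2\<close> between the squared distances of a far and a near
    grid point. The logarithm pays for up to \<open>n + 1\<close> far terms; the absolute value
    keeps \<open>t\<close> nonnegative when \<open>e\<close> is large.\<close>
  define t where "t = \<bar>ln ((real n + 1) / e)\<bar> / (3 / 4 * d\<^sup>2)"
  have t0: "0 \<le> t" by (simp add: t_def)
  have "t * (3 / 4 * d\<^sup>2) = \<bar>ln ((real n + 1) / e)\<bar>" using d by (simp add: t_def)
  then have "exp (- (t * (3 / 4 * d\<^sup>2))) \<le> exp (- ln ((real n + 1) / e))" by simp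
  also have "\<dots> = e / (real n + 1)" using e by (simp add: exp_minus)
  finally have te: "(real n + 1) * exp (- (t * (3 / 4 * d\<^sup>2))) \<le> e" by (simp add: field_simps)
  show thesis
  proof (rule that[OF n0])
    fix x :: real assume x: "x \<in> {0..1}"
    define G where "G i = exp (t * (2 * (real i / real n) * x - (real i / real n)\<^sup>2))" for i :: nat
    have G: "G i = exp (t * x\<^sup>2 - t * (x - real i / real n)\<^sup>2)" for i
      by (simp add: G_def power2_eq_square algebra_simps)
    \<comment> \<open>The grid point at or just left of \<open>x\<close>, hence within
      \<open>1 / n \<le> d / 2\<close> of it; \<open>x \<le> 1\<close> gives
      \<open>j \<le> n\<close>.\<close>
    define j where "j = nat \<lfloor>x * real n\<rfloor>"
    have "real j \<le> x * real n" "x * real n < real j + 1"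
      using x unfolding j_def by (auto simp: of_nat_nat)
    then have "\<bar>x * real n - real j\<bar> / real n \<le> 1 / real n" by (intro divide_right_mono) auto
    also have "\<bar>x * real n - real j\<bar> / real n = \<bar>(x * real n - real j) / real n\<bar>" by simp
    also have "(x * real n - real j) / real n = x - real j / real n" using n0 by (simp add: diff_divide_distrib)
    finally have j: "\<bar>x - real j / real n\<bar> \<le> 1 / real n" .
    have "real j \<le> real n" using \<open>real j \<le> x * real n\<close> x
      by (meson atLeastAtMost_iff mult_left_le_one_le of_nat_0_le_iff order_trans)
    then have jn: "j \<le> n" by simp
    have far: "G i \<le> exp (- (t * (3 / 4 * d\<^sup>2))) * G j" if "d \<le> \<bar>x - real i / real n\<bar>" for i
    proof -
      have "(x - real j / real n)\<^sup>2 \<le> (d / 2)\<^sup>2" using j nd by (intro abs_le_square_iff[THEN iffD1]) auto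
      moreover have "d\<^sup>2 \<le> (x - real i / real n)\<^sup>2" using that d by (intro abs_le_square_iff[THEN iffD1]) auto
      ultimately have "3 / 4 * d\<^sup>2 + (x - real j / real n)\<^sup>2 \<le> (x - real i / real n)\<^sup>2"
        by (simp add: power_divide)
      from mult_left_mono[OF this t0] show ?thesis
        unfolding G by (simp add: distrib_left flip: exp_add)
    qed
    have "(\<Sum>i\<in>{i\<in>{..n}. d \<le> \<bar>x - real i / real n\<bar>}. G i)
        \<le> (\<Sum>i\<in>{i\<in>{..n}. d \<le> \<bar>x - real i / real n\<bar>}. exp (- (t * (3 / 4 * d\<^sup>2))) * G j)"
      by (intro sum_mono far) auto
    also have "\<dots> \<le> (\<Sum>i\<le>n. exp (- (t * (3 / 4 * d\<^sup>2))) * G j)"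
      by (intro sum_mono2) (auto simp: G_def)
    also have "\<dots> = ((real n + 1) * exp (- (t * (3 / 4 * d\<^sup>2)))) * G j" by (simp add: algebra_simps)
    also have "\<dots> \<le> e * G j" using te by (intro mult_right_mono) (auto simp: G_def)
    also have "\<dots> \<le> e * (\<Sum>i\<le>n. G i)"
      using e jn by (intro mult_left_mono member_le_sum) (auto simp: G_def)
    finally show "(\<Sum>i\<in>{i\<in>{..n}. d \<le> \<bar>x - real i / real n\<bar>}. exp (t * (2 * (real i / real n) * x - (real i / real n)\<^sup>2)))
      \<le> e * (\<Sum>i\<le>n. exp (t * (2 * (real i / real n) * x - (real i / real n)\<^sup>2)))"
      by (simp add: G_def)
  qed
qed

section \<open>Nested mixtures as members of the soft-max class\<close>

lemma loc_scale_ess_bounded: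
  fixes \<psi> :: "real ^ 'q \<Rightarrow> real"
  assumes "compact Y" "continuous_on UNIV \<psi>"
  shows "loc_scale \<psi> \<mu> \<sigma> \<in> ess_bounded (lebesgue_on Y)"
proof -
  have c: "continuous_on Y (loc_scale \<psi> \<mu> \<sigma>)"
    unfolding loc_scale_def divide_inverse
    by (intro continuous_intros continuous_on_compose2[OF assms(2)]) auto
  have "bounded (loc_scale \<psi> \<mu> \<sigma> ` Y)"
    by (intro compact_imp_bounded compact_continuous_image c assms(1))
  then obtain C where "\<forall>y\<in>Y. \<bar>loc_scale \<psi> \<mu> \<sigma> y\<bar> \<le> C" unfolding bounded_iff by auto
  moreover have "loc_scale \<psi> \<mu> \<sigma> \<in> borel_measurable (lebesgue_on Y)"
    using c assms(1) by (intro continuous_imp_measurable_on_sets_lebesgue) (auto intro: fmeasurableD lmeasurable_compact)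
  ultimately show ?thesis
    unfolding ess_bounded_def by (auto intro!: exI[of _ C])
qed

text \<open>The pairs \<open>(i, t)\<close> become the experts of one flat mixture, with intercept
  \<open>a i + ln (w i t)\<close> and slope \<open>b i\<close>. Since the weights over each
  \<open>T i\<close> sum to one, the flat normaliser equals the outer one, so outer gate times inner
  weight is again a soft-max gate.\<close>

lemma nested_mixture_in_softmax_moe:
  fixes \<psi> :: "real ^ 'q \<Rightarrow> real" and a b :: "'i \<Rightarrow> real" and w :: "'i \<Rightarrow> real ^ 'q \<Rightarrow> real"
  assumes Y: "compact Y" and \<psi>: "continuous_on UNIV \<psi>" "\<And>z. 0 \<le> \<psi> z" and \<sigma>: "0 < \<sigma>"
    and I: "finite I" "I \<noteq> {}"
    and T: "\<And>i. i \<in> I \<Longrightarrow> finite (T i)" "\<And>i. i \<in> I \<Longrightarrow> T i \<subseteq> Y"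
    and w: "\<And>i t. i \<in> I \<Longrightarrow> t \<in> T i \<Longrightarrow> 0 < w i t" "\<And>i. i \<in> I \<Longrightarrow> (\<Sum>t\<in>T i. w i t) = 1"
  shows "(\<lambda>(x, y). (\<Sum>i\<in>I. exp (a i + b i * x) * (\<Sum>t\<in>T i. w i t * loc_scale \<psi> t \<sigma> y))
      / (\<Sum>i\<in>I. exp (a i + b i * x))) \<in> softmax_moe \<psi> X Y"
    (is "?m \<in> _")
proof -
  have ls0: "0 \<le> loc_scale \<psi> t \<sigma> y" for t y using \<psi>(2) \<sigma> by (simp add: loc_scale_def)
  define S where "S = Sigma I T"
  have Sfin: "finite S" unfolding S_def using I T by auto
  have "T i \<noteq> {}" if "i \<in> I" for i using w(2)[OF that] by auto
  then have Sne: "S \<noteq> {}" using I(2) by (auto simp: S_def)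
  obtain h where h: "bij_betw h {1..card S} S" using ex_bij_betw_nat_finite_1[OF Sfin] by auto
  define W where "W x s = w (fst s) (snd s) * exp (a (fst s) + b (fst s) * x)" for x s
  have reidx: "(\<Sum>k=1..card S. F (h k)) = (\<Sum>i\<in>I. \<Sum>t\<in>T i. F (i, t))" for F :: "'i \<times> (real ^ 'q) \<Rightarrow> real"
    using sum.reindex_bij_betw[OF h, of F] sum.Sigma[of I T "\<lambda>i t. F (i, t)"] I T by (simp add: S_def)
  define \<alpha> where "\<alpha> k = a (fst (h k)) + ln (w (fst (h k)) (snd (h k)))" for k
  define \<beta> where "\<beta> k = b (fst (h k))" for k
  have hS: "h k \<in> S" if "k \<in> {1..card S}" for k using h that by (auto simp: bij_betw_def)
  have Wexp: "exp (\<alpha> k + \<beta> k * x) = W x (h k)" if "k \<in> {1..card S}" for k x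
  proof -
    have "0 < w (fst (h k)) (snd (h k))" using hS[OF that] w(1) by (auto simp: S_def)
    then show ?thesis by (simp add: \<alpha>_def \<beta>_def W_def exp_add)
  qed
  have Wsum: "(\<Sum>k=1..card S. exp (\<alpha> k + \<beta> k * x)) = (\<Sum>k=1..card S. W x (h k))" for x
    by (intro sum.cong Wexp) auto
  have denom: "(\<Sum>k=1..card S. W x (h k)) = (\<Sum>i\<in>I. exp (a i + b i * x))" for x
    unfolding reidx by (auto simp: W_def w(2) simp flip: sum_distrib_right intro!: sum.cong)
  define Gate where "Gate k x = exp (\<alpha> k + \<beta> k * x) / (\<Sum>l=1..card S. exp (\<alpha> l + \<beta> l * x))" for k x
  have gate: "Gate k x = W x (h k) / (\<Sum>i\<in>I. exp (a i + b i * x))" if "k \<in> {1..card S}" for k x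
    unfolding Gate_def Wsum denom Wexp[OF that] ..
  have m: "?m (x, y) = (\<Sum>k=1..card S. Gate k x * loc_scale \<psi> (snd (h k)) \<sigma> y)" for x y
  proof -
    have "(\<Sum>k=1..card S. Gate k x * loc_scale \<psi> (snd (h k)) \<sigma> y)
       = (\<Sum>k=1..card S. W x (h k) * loc_scale \<psi> (snd (h k)) \<sigma> y) / (\<Sum>i\<in>I. exp (a i + b i * x))"
      by (simp add: gate sum_divide_distrib)
    also have "(\<Sum>k=1..card S. W x (h k) * loc_scale \<psi> (snd (h k)) \<sigma> y)
       = (\<Sum>i\<in>I. exp (a i + b i * x) * (\<Sum>t\<in>T i. w i t * loc_scale \<psi> t \<sigma> y))"
      unfolding reidx[of "\<lambda>s. W x s * loc_scale \<psi> (snd s) \<sigma> y"]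
      by (simp add: W_def sum_distrib_left mult_ac)
    finally show ?thesis by simp
  qed
  show ?thesis
    unfolding softmax_moe_def
  proof (intro CollectI conjI exI)
    show "?m \<in> X \<times> Y \<rightarrow> {0..}"
    proof (rule Pi_I)
      fix z :: "real \<times> (real ^ 'q)"
      show "?m z \<in> {0..}"
        unfolding case_prod_beta atLeast_iff
        by (intro divide_nonneg_nonneg sum_nonneg mult_nonneg_nonneg ls0 exp_ge_zero) (simp add: w(1) less_imp_le)
    qed
    show "1 \<le> card S" using Sfin Sne by (simp add: Suc_le_eq card_gt_0_iff)
    show "Gate \<in> softmax_gates (card S) X" unfolding softmax_gates_def Gate_def by blast
    show "\<forall>k\<in>{1..card S}. snd (h k) \<in> Y \<and> 0 < \<sigma> \<and>
        loc_scale \<psi> (snd (h k)) \<sigma> \<in> loc_scale_class \<psi> Y \<inter> ess_bounded (lebesgue_on Y)"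
      using hS T(2) \<sigma> loc_scale_ess_bounded[OF Y \<psi>(1)]
      by (fastforce simp: S_def loc_scale_class_def)
    show "\<forall>x\<in>X. \<forall>y\<in>Y. ?m (x, y) = (\<Sum>k=1..card S. Gate k x * loc_scale \<psi> (snd (h k)) \<sigma> y)"
      using m by blast
  qed
qed

section \<open>Gluing the finite mixtures along a grid in \<open>x\<close>\<close>

text \<open>The error budget is \<open>e / 4\<close> each for the convolution, its discretisation,
  the variation of \<open>f\<close> between \<open>x\<close> and grid points closer than
  \<open>d\<close>, and the gate mass on the remaining grid points.\<close>

lemma softmax_moe_approx:
  fixes Y :: "(real ^ 'q) set" and f :: "real \<times> (real ^ 'q) \<Rightarrow> real"
  assumes Y: "compact Y" and f: "f \<in> cond_pdfs {0..1} Y" "continuous_on ({0..1} \<times> Y) f"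
    and \<psi>: "is_pdf \<psi>" "continuous_on UNIV \<psi>" and e: "0 < e"
  obtains m E where "m \<in> softmax_moe \<psi> {0..1} Y" "E \<in> sets borel" "E \<subseteq> Y"
    "emeasure lborel E \<le> ennreal e"
    "\<And>x y. x \<in> {0..1} \<Longrightarrow> y \<in> Y - E \<Longrightarrow> \<bar>m (x, y) - f (x, y)\<bar> \<le> e"
proof -
  have Yb[measurable]: "Y \<in> sets borel" using Y by (rule borel_compact)
  have \<psi>m[measurable]: "\<psi> \<in> borel_measurable borel" using \<psi>(2) by (rule borel_measurable_continuous_onI)
  have \<psi>0: "0 \<le> \<psi> z" for z using \<psi>(1) by (simp add: is_pdf_def)
  have \<psi>I: "integrable lborel \<psi>" "integral\<^sup>L lborel \<psi> = 1"
    using \<psi>(1) by (auto simp: is_pdf_def has_bochner_integral_iff integrable_completion integral_completion)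
  have \<psi>1: "(\<integral>\<^sup>+z. ennreal (\<psi> z) \<partial>lborel) = 1"
    using nn_integral_eq_integral[OF \<psi>I(1)] \<psi>0 \<psi>I(2) by simp
  define N where "N = density lborel (\<lambda>z. ennreal (\<psi> z))"
  have N1: "emeasure N UNIV = 1"
    unfolding N_def using \<psi>1 by (subst emeasure_density) auto
  have N: "finite_measure N" "sets N = sets borel" "measure N UNIV = 1"
    using N1 by (auto intro!: finite_measureI simp: N_def measure_def)
  have I: "compact {0..1::real}" by simp
  have IY: "compact ({0..1::real} \<times> Y)" using Y by (intro compact_Times) auto
  obtain M where M: "0 < M" "\<And>p. p \<in> {0..1} \<times> Y \<Longrightarrow> \<bar>f p\<bar> \<le> M"
    using compact_imp_bounded[OF compact_continuous_image[OF f(2) IY]] unfolding bounded_pos by auto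
  have e4: "0 < e / 4" using e by simp
  obtain d where d: "0 < d"
    "\<And>p p'. p \<in> {0..1} \<times> Y \<Longrightarrow> p' \<in> {0..1} \<times> Y \<Longrightarrow> dist p' p < d \<Longrightarrow> dist (f p') (f p) < e/4"
    using uniformly_continuous_onE[OF compact_uniformly_continuous[OF f(2) IY] e4] by metis
  obtain \<sigma> E where E: "0 < \<sigma>" "E \<in> sets borel" "E \<subseteq> Y" "emeasure lborel E \<le> ennreal (e/4)"
    "\<And>x y. x \<in> {0..1} \<Longrightarrow> y \<in> Y - E \<Longrightarrow>
      \<bar>f (x, y) - (\<integral>z. indicator Y (y - \<sigma> *\<^sub>R z) * f (x, y - \<sigma> *\<^sub>R z) \<partial>N)\<bar> \<le> e/4"
    by (rule mollifier_approx[OF N I Y f(2) e4], rule that)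
  define p where "p x \<mu> = indicator Y \<mu> * f (x, \<mu>)" for x \<mu>
  have "continuous_on (Y \<times> Y) (\<lambda>(y, \<mu>). loc_scale \<psi> \<mu> \<sigma> y)"
    unfolding loc_scale_def divide_inverse case_prod_beta
    by (intro continuous_intros continuous_on_compose2[OF \<psi>(2)]) auto
  note kernel = integral_kernel_discretise[OF Y Y this _ _ _ e4]
  \<comment> \<open>The finite mixture is compared with the convolution rather than with
    \<open>f\<close>, so this estimate holds on all of \<open>Y\<close>; \<open>E\<close> enters
    only when the convolution is compared with \<open>f\<close>.\<close>
  define good where "good x T w \<longleftrightarrow> finite T \<and> T \<subseteq> Y \<and> (\<forall>t\<in>T. 0 < w t) \<and> (\<Sum>t\<in>T. w t) = 1 \<and>
      (\<forall>y\<in>Y. \<bar>(\<integral>z. p x (y - \<sigma> *\<^sub>R z) \<partial>N) - (\<Sum>t\<in>T. w t * loc_scale \<psi> t \<sigma> y)\<bar> \<le> e/4)"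
    for x T w
  have "\<exists>T w. good x T w"
    if x: "x \<in> {0..1}" for x
  proof -
    have "continuous_on Y (\<lambda>\<mu>. f (x, \<mu>))"
      using x by (intro continuous_on_compose2[OF f(2)]) (auto intro!: continuous_intros)
    then have "(\<lambda>\<mu>. indicator Y \<mu> *\<^sub>R f (x, \<mu>)) \<in> borel_measurable borel"
      by (intro borel_measurable_continuous_on_indicator Yb)
    then have pm: "p x \<in> borel_measurable borel" by (simp add: p_def[abs_def])
    have "has_bochner_integral (lebesgue_on Y) (\<lambda>y. f (x, y)) 1" using f(1) x by (simp add: cond_pdfs_def)
    then have "has_bochner_integral lebesgue (p x) 1"
      by (subst (asm) has_bochner_integral_restrict_space) (auto simp: p_def[abs_def])
    then have p1: "has_bochner_integral lborel (p x) 1"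
      using pm by (auto simp: has_bochner_integral_iff integrable_completion integral_completion)
    have p0: "0 \<le> p x \<mu>" for \<mu> using f(1) x by (auto simp: p_def cond_pdfs_def indicator_def)
    have pY: "\<mu> \<notin> Y \<Longrightarrow> p x \<mu> = 0" for \<mu> by (simp add: p_def)
    show ?thesis
      unfolding good_def N_def integral_mollifier_eq_loc_scale[OF pm \<psi>m \<psi>0 E(1)]
    proof (rule kernel[OF p1 p0 pY])
      fix T w
      assume "finite T" "T \<subseteq> Y" "\<And>t. t \<in> T \<Longrightarrow> 0 < w t" "(\<Sum>t\<in>T. w t) = 1"
        "\<And>y. y \<in> Y \<Longrightarrow> \<bar>(\<integral>\<mu>. p x \<mu> * (case (y, \<mu>) of (y, \<mu>) \<Rightarrow> loc_scale \<psi> \<mu> \<sigma> y) \<partial>lborel)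
          - (\<Sum>t\<in>T. w t * (case (y, t) of (y, \<mu>) \<Rightarrow> loc_scale \<psi> \<mu> \<sigma> y))\<bar> \<le> e/4"
      then show "\<exists>T w. finite T \<and> T \<subseteq> Y \<and> (\<forall>t\<in>T. 0 < w t) \<and> (\<Sum>t\<in>T. w t) = 1 \<and>
          (\<forall>y\<in>Y. \<bar>(\<integral>\<mu>. p x \<mu> * loc_scale \<psi> \<mu> \<sigma> y \<partial>lborel)
            - (\<Sum>t\<in>T. w t * loc_scale \<psi> t \<sigma> y)\<bar> \<le> e/4)"
        by (intro exI[of _ T] exI[of _ w]) simp
    qed
  qed
  then obtain T w where "\<And>x. x \<in> {0..1} \<Longrightarrow> good x (T x) (w x)" by metis
  note Tw = this[unfolded good_def]
  \<comment> \<open>The experts at far grid points may be off by \<open>e / 2 + 2 * M\<close>; a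
    share \<open>r\<close> of the gate mass on them costs \<open>e / 4\<close>.\<close>
  define r where "r = (e / 4) / (e / 2 + 2 * M)"
  have "0 < e / 2 + 2 * M" using e M(1) by simp
  moreover have "a * (b / a) = b" if "0 < a" for a b :: real using that by simp
  ultimately have r: "0 < r" "(e / 2 + 2 * M) * r = e / 4"
    unfolding r_def using e4 by (blast intro: divide_pos_pos)+
  obtain n t where n: "0 < n" and gate: "\<And>x. x \<in> {0..1} \<Longrightarrow>
      (\<Sum>i\<in>{i\<in>{..n}. d \<le> \<bar>x - real i / real n\<bar>}. exp (t * (2 * (real i / real n) * x - (real i / real n)\<^sup>2)))
      \<le> r * (\<Sum>i\<le>n. exp (t * (2 * (real i / real n) * x - (real i / real n)\<^sup>2)))"
    by (rule softmax_gates_localised[OF d(1) r(1)], rule that)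
  define c where "c i = real i / real n" for i
  have c: "i \<le> n \<Longrightarrow> c i \<in> {0..1}" for i using n by (simp add: c_def)
  define \<alpha> \<beta> where "\<alpha> i = - (t * (c i)\<^sup>2)" and "\<beta> i = t * 2 * c i" for i
  define G where "G i x = exp (\<alpha> i + \<beta> i * x)" for i x
  have G: "G i x = exp (t * (2 * c i * x - (c i)\<^sup>2))" for i x
    by (simp add: G_def \<alpha>_def \<beta>_def algebra_simps)
  define A where "A i y = (\<Sum>t\<in>T (c i). w (c i) t * loc_scale \<psi> t \<sigma> y)" for i y
  define m where "m = (\<lambda>(x, y). (\<Sum>i\<le>n. G i x * A i y) / (\<Sum>i\<le>n. G i x))"
  show thesis
  proof (rule that[OF _ E(2,3)])
    show "m \<in> softmax_moe \<psi> {0..1} Y"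
      unfolding m_def G_def A_def
    proof (rule nested_mixture_in_softmax_moe[OF Y \<psi>(2) \<psi>0 E(1),
          where I = "{..n}" and T = "\<lambda>i. T (c i)" and w = "\<lambda>i. w (c i)"])
      fix i t assume "i \<in> {..n}"
      then have ci: "c i \<in> {0..1}" using c by simp
      note * = Tw[OF ci]
      from * show "finite (T (c i))" by (elim conjE)
      from * show "T (c i) \<subseteq> Y" by (elim conjE)
      from * show "(\<Sum>t\<in>T (c i). w (c i) t) = 1" by (elim conjE)
      from * have "\<forall>t\<in>T (c i). 0 < w (c i) t" by (elim conjE)
      then show "0 < w (c i) t" if "t \<in> T (c i)" using that by (rule bspec)
    qed auto
    show "emeasure lborel E \<le> ennreal e"
      by (rule order_trans[OF E(4)]) (use e in \<open>auto intro!: ennreal_leI\<close>)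
    fix x :: real and y assume x: "x \<in> {0..1}" and y: "y \<in> Y - E"
    define Z where "Z = (\<Sum>i\<le>n. G i x)"
    have G0: "0 < G i x" for i by (simp add: G_def)
    have Z: "0 < Z" unfolding Z_def by (intro sum_pos) (auto simp: G0)
    \<comment> \<open>Convolution and discretisation errors are both taken at the grid point
      \<open>c i\<close>, which leaves the change of \<open>f\<close> from \<open>c i\<close> to
      \<open>x\<close>.\<close>
    have diff: "\<bar>A i y - f (x, y)\<bar> \<le> e / 2 + \<bar>f (c i, y) - f (x, y)\<bar>" if i: "i \<le> n" for i
    proof -
      have "\<bar>(\<integral>z. p (c i) (y - \<sigma> *\<^sub>R z) \<partial>N) - A i y\<bar> \<le> e/4"
        using Tw[OF c[OF i]] y unfolding A_def by (elim conjE) (rule bspec, assumption, simp)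
      moreover have "\<bar>f (c i, y) - (\<integral>z. p (c i) (y - \<sigma> *\<^sub>R z) \<partial>N)\<bar> \<le> e/4"
        using E(5)[OF c[OF i] y] by (simp add: p_def)
      ultimately show ?thesis by linarith
    qed
    \<comment> \<open>The far grid points: there the change of \<open>f\<close> is bounded by
      \<open>2 * M\<close>, elsewhere by \<open>e / 4\<close> through uniform continuity.\<close>
    define D where "D = {i\<in>{..n}. d \<le> \<bar>x - c i\<bar>}"
    have pt: "\<bar>A i y - f (x, y)\<bar> \<le> 3 / 4 * e + (e / 2 + 2 * M) * indicator D i" if i: "i \<le> n" for i
    proof (cases "d \<le> \<bar>x - c i\<bar>")
      case True
      have "\<bar>f (c i, y)\<bar> \<le> M" "\<bar>f (x, y)\<bar> \<le> M" using M(2) c[OF i] x y by auto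
      then have "\<bar>A i y - f (x, y)\<bar> \<le> e / 2 + 2 * M" using diff[OF i] by linarith
      then show ?thesis using True i e by (simp add: D_def)
    next
      case False
      then have "dist (c i, y) (x, y) < d" by (simp add: dist_Pair_Pair dist_real_def)
      then have "dist (f (c i, y)) (f (x, y)) < e / 4" using x y c[OF i] by (intro d(2)) auto
      then show ?thesis using diff[OF i] False by (simp add: D_def dist_real_def)
    qed
    have "m (x, y) - f (x, y) = (\<Sum>i\<le>n. G i x * (A i y - f (x, y))) / Z"
      using Z by (simp add: m_def Z_def right_diff_distrib sum_subtractf diff_divide_distrib flip: sum_distrib_right)
    also have "\<bar>\<dots>\<bar> = \<bar>\<Sum>i\<le>n. G i x * (A i y - f (x, y))\<bar> / Z" using Z by simp
    also have "\<dots> \<le> (\<Sum>i\<le>n. G i x * (3 / 4 * e + (e / 2 + 2 * M) * indicator D i)) / Z"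
    proof (intro divide_right_mono order_trans[OF sum_abs] sum_mono)
      fix i assume "i \<in> {..n}"
      then show "\<bar>G i x * (A i y - f (x, y))\<bar> \<le> G i x * (3 / 4 * e + (e / 2 + 2 * M) * indicator D i)"
        using pt[of i] G0[of i] by (simp add: abs_mult)
    qed (use Z in simp)
    also have "(\<Sum>i\<le>n. G i x * (3 / 4 * e + (e / 2 + 2 * M) * indicator D i))
        = 3 / 4 * e * Z + (e / 2 + 2 * M) * (\<Sum>i\<in>D. G i x)"
    proof -
      have "(\<Sum>i\<in>D. G i x) = (\<Sum>i\<le>n. G i x * indicator D i)"
        by (intro sum.mono_neutral_cong_left) (auto simp: D_def)
      moreover have "(\<Sum>i\<le>n. G i x * (3 / 4 * e + (e / 2 + 2 * M) * indicator D i))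
          = (\<Sum>i\<le>n. 3 / 4 * e * G i x + (e / 2 + 2 * M) * (G i x * indicator D i))"
        by (intro sum.cong refl) (simp only: distrib_left mult_ac)
      ultimately show ?thesis by (simp only: Z_def sum.distrib sum_distrib_left)
    qed
    also have "\<dots> \<le> 3 / 4 * e * Z + (e / 2 + 2 * M) * (r * Z)"
      using gate[OF x] e M(1) by (intro add_left_mono mult_left_mono) (auto simp: G c_def D_def Z_def)
    also have "\<dots> = e * Z" unfolding mult.assoc[symmetric] r(2) by simp
    finally show "\<bar>m (x, y) - f (x, y)\<bar> \<le> e" using Z by (simp add: divide_right_mono)
  qed
qed

section \<open>From approximation to almost uniform convergence\<close>

theorem theorem2:
  fixes Y :: "(real ^ 'q) set"
    and f :: "real \<times> (real ^ 'q) \<Rightarrow> real"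
    and \<psi> :: "real ^ 'q \<Rightarrow> real"
  assumes "compact Y"
    and "f \<in> cond_pdfs {0..1} Y"
    and "continuous_on ({0..1} \<times> Y) f"
    and "is_pdf \<psi>"
    and "continuous_on UNIV \<psi>"
  shows "\<exists>m :: nat \<Rightarrow> real \<times> (real ^ 'q) \<Rightarrow> real.
           (\<forall>K. m K \<in> softmax_moe \<psi> {0..1} Y) \<and>
           almost_uniform_limit ({0..1} \<times> Y) m f"
proof -
  \<comment> \<open>Summable tolerances, so that tail unions of the exceptional sets have small
    measure, as in the Borel-Cantelli lemma.\<close>
  define e :: "nat \<Rightarrow> real" where "e k = (1/2) ^ k" for k
  have "\<exists>m E. m \<in> softmax_moe \<psi> {0..1} Y \<and> E \<in> sets borel \<and> E \<subseteq> Y \<and>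
      emeasure lborel E \<le> ennreal (e k) \<and> (\<forall>x\<in>{0..1}. \<forall>y\<in>Y - E. \<bar>m (x, y) - f (x, y)\<bar> \<le> e k)" for k
  proof -
    have "0 < e k" by (simp add: e_def)
    from softmax_moe_approx[OF assms this] show ?thesis by metis
  qed
  then obtain m E where mE: "\<And>k. m k \<in> softmax_moe \<psi> {0..1} Y" "\<And>k. E k \<in> sets borel"
      "\<And>k. E k \<subseteq> Y" "\<And>k. emeasure lborel (E k) \<le> ennreal (e k)"
      "\<And>k x y. x \<in> {0..1} \<Longrightarrow> y \<in> Y - E k \<Longrightarrow> \<bar>m k (x, y) - f (x, y)\<bar> \<le> e k"
    by metis
  have "almost_uniform_limit ({0..1} \<times> Y) m f"
    unfolding almost_uniform_limit_def
  proof (intro allI impI)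
    fix \<delta> :: real assume \<delta>: "0 < \<delta>"
    \<comment> \<open>The geometric tail from \<open>n\<close> on sums to
      \<open>2 * (1/2) ^ n\<close>, hence the target \<open>\<delta> / 2\<close>.\<close>
    obtain n where n: "(1/2) ^ n < \<delta> / 2" using \<delta> real_arch_pow_inv[of "\<delta>/2" "1/2"] by auto
    define B where "B = (\<Union>k. E (k + n))"
    have Bb: "B \<in> sets borel" unfolding B_def using mE(2) by auto
    have "(\<lambda>k. (1/2) ^ n * (1/2) ^ k :: real) sums ((1/2) ^ n * 2)"
      using geometric_sums[of "1/2::real"] by (intro sums_mult) simp
    then have S: "(\<lambda>k. e (k + n)) sums ((1/2) ^ n * 2)" by (simp add: e_def power_add mult.commute)
    have "emeasure lborel B \<le> (\<Sum>k. emeasure lborel (E (k + n)))"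
      unfolding B_def using mE(2) by (intro emeasure_subadditive_countably) auto
    also have "\<dots> \<le> (\<Sum>k. ennreal (e (k + n)))" by (intro suminf_le mE(4)) auto
    also have "\<dots> = ennreal ((1/2) ^ n * 2)" using S by (intro suminf_ennreal_eq) (auto simp: e_def)
    finally have B: "emeasure lborel B \<le> ennreal ((1/2) ^ n * 2)" .
    have ZB: "{0..1::real} \<times> B \<in> sets borel" using Bb by (intro borel_Times) auto
    \<comment> \<open>The exceptional sets constrain \<open>y\<close> only, and the unit interval
      has length 1, so the product has the measure of \<open>B\<close>.\<close>
    have "emeasure lebesgue ({0..1::real} \<times> B) = emeasure (lborel \<Otimes>\<^sub>M lborel) ({0..1::real} \<times> B)"
      using ZB by (simp add: lborel_prod)
    also have "\<dots> = emeasure lborel B"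
      using Bb by (subst lborel.emeasure_pair_measure_Times) auto
    also note B
    also have "ennreal ((1/2) ^ n * 2) < ennreal \<delta>" using n \<delta> by (intro ennreal_lessI) auto
    finally have small: "emeasure lebesgue ({0..1::real} \<times> B) < ennreal \<delta>" .
    have "uniform_limit ({0..1} \<times> Y - {0..1} \<times> B) m f sequentially"
    proof (rule uniform_limitI)
      fix \<epsilon> :: real assume \<epsilon>: "0 < \<epsilon>"
      have "e \<longlonglongrightarrow> 0" unfolding e_def by (rule LIMSEQ_power_zero) auto
      then have "\<forall>\<^sub>F k in sequentially. e k < \<epsilon>" using \<epsilon> by (rule order_tendstoD(2))
      with eventually_ge_at_top[of n]
      show "\<forall>\<^sub>F k in sequentially. \<forall>z\<in>{0..1} \<times> Y - {0..1} \<times> B. dist (m k z) (f z) < \<epsilon>"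
      proof eventually_elim
        case (elim k)
        \<comment> \<open>For \<open>k \<ge> n\<close> the set \<open>E k\<close> is the member of
          the union with index \<open>k - n\<close>, so off \<open>B\<close> the error bound
          \<open>e k\<close> applies.\<close>
        have "E k \<subseteq> B" using elim(1) unfolding B_def by (auto intro!: exI[of _ "k - n"])
        then show ?case using mE(5)[of _ _ k] elim(2) by (fastforce simp: dist_real_def)
      qed
    qed
    moreover have "{0..1::real} \<times> B \<subseteq> {0..1} \<times> Y" using mE(3) by (auto simp: B_def)
    ultimately show "\<exists>E. E \<in> sets lebesgue \<and> E \<subseteq> {0..1} \<times> Y \<and> emeasure lebesgue E < ennreal \<delta> \<and>
       uniform_limit ({0..1} \<times> Y - E) m f sequentially"
      using small ZB by (intro exI[of _ "{0..1} \<times> B"]) auto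
  qed
  with mE(1) show ?thesis by blast
qed

end
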